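(* Define polynomials $b(m,n)$ in $q$, for integers $m,n$, by $b(0,0)=1$, $b(m,n)=0$ if $m<0$ or $n<0$, and, for all $m,n\ge 0$ with $(m,n)\neq(0,0)$, $$b(m,n)=\left(1+q+q^2+\cdots+q^{2m+n-2}\right)b(m-1,n)+q^m\,b(m,n-1).$$ Then, as formal power series in $x$ and $q$, $$\frac{(x^3q^3;q^3)_\infty}{(xq;q)_\infty}=\sum_{m,n\ge 0}\frac{q^{\binom{m+n+1}{2}+\binom{m+1}{2}}(1-q)^m x^{2m+n}}{(q;q)_{2m+n}}\,b(m,n).$$
   Context: Notation: $(a;q)_n=\prod_{j=1}^n(1-aq^{j-1})$ (so $(a;q)_0=1$) and $(a;q)_\infty=\lim_{n\to\infty}(a;q)_n=\prod_{j\ge1}(1-aq^{j-1})$; similarly $(a;q^3)_\infty=\prod_{j\ge 1}(1-aq^{3(j-1)})$. In the recurrence, a term in which $b$ has a negative argument is read as $0$ (so the factor $1+q+\cdots+q^{2m+n-2}$ only matters when $m\ge1$, in which case $2m+n-2\ge0$). *)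

theory Defs
  imports "HOL-Analysis.Analysis"
begin

definition qpoch :: "'a::comm_ring_1 \<Rightarrow> 'a \<Rightarrow> nat \<Rightarrow> 'a" where
  "qpoch a q n = (\<Prod>j=1..n. 1 - a * q ^ (j - 1))"

definition qpoch_inf :: "'a::{comm_ring_1, t2_space} \<Rightarrow> 'a \<Rightarrow> 'a" where
  "qpoch_inf a q = lim (qpoch a q)"

(* The number of summands 2m+n-1 can be negative only for (m,n) = (0,0), which is excluded;
   for m = 0 the sum is multiplied by bpoly (-1) n = 0. *)
function bpoly :: "int \<Rightarrow> int \<Rightarrow> int poly" where
  "bpoly m n =
    (if m < 0 \<or> n < 0 then 0
     else if m = 0 \<and> n = 0 then 1
     else (\<Sum>i<nat (2 * m + n - 1). monom 1 i) * bpoly (m - 1) n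
          + monom 1 (nat m) * bpoly m (n - 1))"
  by pat_completeness auto
termination
  by (relation "Wellfounded.measure (\<lambda>(m, n). nat (m + 1) + nat (n + 1))") auto

declare bpoly.simps [simp del]

(* Formal power series in x and q over the rationals are elements of Q[[x]][[q]]: the outer
   variable is q.  The library topology on this type is the q-adic one (the coefficient ring
   Q[[x]] counts as discrete); it is finer than the (x,q)-adic one.  With the variables nested
   the other way round, the infinite products in question would not converge in the library topology. *)

abbreviation var_q :: "rat fps fps" where "var_q \<equiv> fps_X"

abbreviation var_x :: "rat fps fps" where "var_x \<equiv> fps_const fps_X"

(* lim is unspecified on divergent sequences; the ones used here converge. *)

lemma qpoch_tendsto_qpoch_inf:
  fixes a p :: "'a::comm_ring_1 fps"
  assumes "fps_nth p 0 = 0"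
  shows "qpoch a p \<longlonglongrightarrow> qpoch_inf a p"
proof -
  have coeff_Suc: "fps_nth (qpoch a p (Suc n)) k = fps_nth (qpoch a p n) k" if "k < n" for n k
  proof -
    have zero: "fps_nth (p ^ n) i = 0" if "i < n" for i
      using startsby_zero_power_prefix[OF assms] that by blast
    have "qpoch a p (Suc n) = qpoch a p n * (1 - a * p ^ n)"
      unfolding qpoch_def by simp
    then have "qpoch a p (Suc n) = qpoch a p n - (a * qpoch a p n) * p ^ n"
      by (simp only: right_diff_distrib mult_1_right mult_1_left ac_simps)
    moreover have "fps_nth ((a * qpoch a p n) * p ^ n) k = 0"
      unfolding fps_mult_nth[of "a * qpoch a p n"]
      by (intro sum.neutral ballI) (use that zero in simp)
    ultimately show ?thesis by simp
  qed
  have stab: "fps_nth (qpoch a p n) k = fps_nth (qpoch a p (Suc k)) k" if "Suc k \<le> n" for n k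
    using that
  proof (induction n rule: dec_induct)
    case base
    show ?case by (rule refl)
  next
    case (step n)
    then show ?case using coeff_Suc[of k n] by (metis Suc_le_lessD)
  qed
  have "qpoch a p \<longlonglongrightarrow> Abs_fps (\<lambda>k. fps_nth (qpoch a p (Suc k)) k)"
  proof (rule tendsto_fpsI)
    fix k
    show "eventually (\<lambda>n. fps_nth (qpoch a p n) k
            = fps_nth (Abs_fps (\<lambda>k. fps_nth (qpoch a p (Suc k)) k)) k) sequentially"
      unfolding fps_nth_Abs_fps
      by (rule eventually_mono[OF eventually_ge_at_top[of "Suc k"]]) (rule stab)
  qed
  then show ?thesis
    unfolding qpoch_inf_def by (metis limI)
qed

end

theory Submission
  imports Defs
begin

text \<open>
  Write \<open>F(x)\<close> for the quotient of products. Since \<open>(1 - z\<^sup>3) = (1 - z) (1 + z + z\<^sup>2)\<close>, it is the product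
  of the factors \<open>1 + x q\<^sup>j + x\<^sup>2 q\<^sup>2\<^sup>j\<close> over \<open>j \<ge> 1\<close>, so that
  \<open>F(x) = (1 + x q + x\<^sup>2 q\<^sup>2) F(x q)\<close>. For the coefficients \<open>f\<^sub>N\<close> of \<open>x\<^sup>N\<close> in \<open>F\<close> this functional equation
  says \<open>(1 - q\<^sup>N) f\<^sub>N = q\<^sup>N (f\<^sub>N\<^sub>-\<^sub>1 + f\<^sub>N\<^sub>-\<^sub>2)\<close>; for \<open>g\<^sub>N = (q;q)\<^sub>N f\<^sub>N\<close> it becomes
  \<open>g\<^sub>N = q\<^sup>N (g\<^sub>N\<^sub>-\<^sub>1 + (1 - q\<^sup>N\<^sup>-\<^sup>1) g\<^sub>N\<^sub>-\<^sub>2)\<close>.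

  The right-hand side satisfies the same recurrence term by term. Put
  \<open>w(m,n) = q\<^sup>e (1 - q)\<^sup>m b(m,n)\<close>, where \<open>e\<close> is the quadratic exponent of the theorem. Passing from
  \<open>(m,n)\<close> to \<open>(m-1,n)\<close> lowers \<open>e\<close> by \<open>2m + n\<close>, and passing to \<open>(m,n-1)\<close> lowers it by \<open>m + n\<close>, to which
  the recurrence of \<open>b\<close> contributes the missing \<open>m\<close> through its factor \<open>q\<^sup>m\<close>. Hence this recurrence turns into
  \<open>w(m,n) = q\<^sup>N ((1 - q\<^sup>N\<^sup>-\<^sup>1) w(m-1,n) + w(m,n-1))\<close> with \<open>N = 2m + n\<close>
  (\<open>weight_recurrence\<close>). Its coefficients depend on \<open>N\<close> only, so it can be summed over all \<open>(m,n)\<close> with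
  \<open>2m + n = N\<close> (\<open>layer_sum_recurrence\<close>).

  To avoid a substitution operator \<open>x \<mapsto> x q\<close> on power series, the functional equation is used in the
  form of congruences modulo \<open>q\<^sup>N\<close> between the partial sums \<open>\<Sum>n\<le>N+1. f\<^sub>n (x q\<^sup>i)\<^sup>n\<close> for all \<open>i\<close>
  (\<open>partial_sum_shift\<close>). Iterating from \<open>i = 0\<close> to \<open>i = N\<close> collects the first \<open>N\<close> factors of the product,
  and the partial sum that remains at \<open>i = N\<close> is \<open>1\<close> modulo \<open>q\<^sup>N\<close> (\<open>partial_sum_cong_product\<close>). The theorem
  is the \<open>q\<close>-adic limit of this congruence.
\<close>

section \<open>Evaluation of integer polynomials in a commutative ring\<close>

definition int_poly_eval :: "'a::comm_ring_1 \<Rightarrow> int poly \<Rightarrow> 'a" where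
  "int_poly_eval q p = poly (map_poly of_int p) q"

lemma int_poly_eval_simps [simp]:
  "int_poly_eval q 0 = 0"
  "int_poly_eval q 1 = 1"
  "int_poly_eval q (pCons a p) = of_int a + q * int_poly_eval q p"
  by (simp_all add: int_poly_eval_def map_poly_pCons)

lemma int_poly_eval_add [simp]:
  "int_poly_eval q (p + r) = int_poly_eval q p + int_poly_eval q r"
proof (induction p arbitrary: r)
  case (pCons a p)
  show ?case
    by (cases r) (simp add: pCons.IH distrib_left add.assoc add.left_commute)
qed simp

lemma int_poly_eval_smult [simp]:
  "int_poly_eval q (smult a p) = of_int a * int_poly_eval q p"
  by (induction p) (simp_all add: algebra_simps)

lemma int_poly_eval_mult [simp]:
  "int_poly_eval q (p * r) = int_poly_eval q p * int_poly_eval q r"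
  by (induction p) (simp_all add: algebra_simps)

lemma int_poly_eval_sum [simp]:
  "int_poly_eval q (sum p A) = (\<Sum>i\<in>A. int_poly_eval q (p i))"
  by (induction A rule: infinite_finite_induct) simp_all

lemma int_poly_eval_monom_1 [simp]: "int_poly_eval q (monom 1 n) = q ^ n"
  by (induction n) (simp_all add: monom_Suc monom_0)


section \<open>The recurrence of the numerators\<close>

text \<open>
  This is the \<open>(m,n)\<close> term of the double series without its denominator \<open>(q;q)\<^sub>2\<^sub>m\<^sub>+\<^sub>n\<close> and its power of \<open>x\<close>,
  both of which depend on \<open>2m + n\<close> only.
\<close>

definition weight :: "'a::comm_ring_1 \<Rightarrow> nat \<Rightarrow> nat \<Rightarrow> 'a" where
  "weight q m n = q ^ (((m + n + 1) choose 2) + ((m + 1) choose 2)) * (1 - q) ^ m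
                    * int_poly_eval q (bpoly (int m) (int n))"

lemma choose_two_Suc: "(Suc k choose 2) = k + (k choose 2)"
  by (simp add: numeral_2_eq_2)

lemma weight_0_0: "weight q 0 0 = 1"
  by (simp add: weight_def bpoly.simps numeral_2_eq_2)

text \<open>
  The factor \<open>1 + q + ... + q\<^sup>2\<^sup>m\<^sup>+\<^sup>n\<^sup>-\<^sup>2\<close> and one of the \<open>m\<close> factors \<open>1 - q\<close> combine to
  \<open>1 - q\<^sup>2\<^sup>m\<^sup>+\<^sup>n\<^sup>-\<^sup>1\<close>; this is what the power of \<open>1 - q\<close> in the theorem is for.
\<close>

lemma weight_recurrence:
  assumes "2 * m + n = Suc N"
  shows "weight q m n = q ^ Suc N *
           ((1 - q ^ N) * (case m of 0 \<Rightarrow> 0 | Suc m' \<Rightarrow> weight q m' n)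
            + (case n of 0 \<Rightarrow> 0 | Suc n' \<Rightarrow> weight q m n'))"
proof -
  let ?b = "\<lambda>m n. int_poly_eval q (bpoly m n)"
  let ?e = "\<lambda>m n. ((m + n + 1) choose 2) + ((m + 1) choose 2)"
  have "nat (2 * int m + int n - 1) = N"
    using assms by linarith
  then have b: "?b (int m) (int n)
      = (\<Sum>i<N. q ^ i) * ?b (int m - 1) (int n) + q ^ m * ?b (int m) (int n - 1)"
    using assms by (subst bpoly.simps) auto
  have first: "q ^ ?e m n * (1 - q) ^ m * ((\<Sum>i<N. q ^ i) * ?b (int m - 1) (int n))
      = q ^ Suc N * ((1 - q ^ N) * (case m of 0 \<Rightarrow> 0 | Suc m' \<Rightarrow> weight q m' n))"
  proof (cases m)
    case 0
    then show ?thesis by (simp add: bpoly.simps)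
  next
    case (Suc m')
    have "?e m n = Suc N + ?e m' n"
      using assms Suc by (simp add: choose_two_Suc)
    then have "q ^ ?e m n = q ^ Suc N * q ^ ?e m' n"
      by (simp only: power_add)
    moreover have "1 - q ^ N = (1 - q) * (\<Sum>i<N. q ^ i)"
      by (rule one_diff_power_eq)
    ultimately show ?thesis
      using Suc by (simp add: weight_def mult_ac)
  qed
  have second: "q ^ ?e m n * (1 - q) ^ m * (q ^ m * ?b (int m) (int n - 1))
      = q ^ Suc N * (case n of 0 \<Rightarrow> 0 | Suc n' \<Rightarrow> weight q m n')"
  proof (cases n)
    case 0
    then show ?thesis by (simp add: bpoly.simps)
  next
    case (Suc n')
    have "?e m n + m = Suc N + ?e m n'"
      using assms Suc by (simp add: choose_two_Suc)
    then have "q ^ ?e m n * q ^ m = q ^ Suc N * q ^ ?e m n'"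
      by (simp only: power_add [symmetric])
    moreover have "q ^ ?e m n * (1 - q) ^ m * (q ^ m * ?b (int m) (int n - 1))
        = (q ^ ?e m n * q ^ m) * ((1 - q) ^ m * ?b (int m) (int n - 1))"
      by (simp only: mult_ac)
    ultimately show ?thesis
      using Suc by (simp add: weight_def mult_ac)
  qed
  show ?thesis
    unfolding distrib_left first [symmetric] second [symmetric]
    by (simp add: weight_def b distrib_left)
qed

text \<open>
  The quadratic exponent is at least \<open>2m + n\<close>. Hence the double series converges in the \<open>q\<close>-adic
  topology, and its order in \<open>q\<close> is controlled by the power of \<open>x\<close>.
\<close>

lemma power_dvd_weight: "q ^ (2 * m + n) dvd weight q m n"
proof -
  have "k \<le> (k + 1) choose 2" for k
    by (simp add: choose_two_Suc)
  from add_mono [OF this [of "m + n"] this [of m]]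
  have "2 * m + n \<le> ((m + n + 1) choose 2) + ((m + 1) choose 2)"
    by simp
  then show ?thesis
    unfolding weight_def by (intro dvd_mult2 le_imp_power_dvd)
qed

definition layer :: "nat \<Rightarrow> (nat \<times> nat) set" where
  "layer N = {(m, n). 2 * m + n = N}"

lemma finite_layer [simp]: "finite (layer N)"
  by (rule finite_subset [of _ "{..N} \<times> {..N}"]) (auto simp: layer_def)

definition layer_sum :: "'a::comm_ring_1 \<Rightarrow> nat \<Rightarrow> 'a" where
  "layer_sum q N = (\<Sum>(m, n)\<in>layer N. weight q m n)"

lemma sum_layer_pred_fst:
  "(\<Sum>(m, n)\<in>layer (Suc (Suc N)). case m of 0 \<Rightarrow> 0 | Suc m' \<Rightarrow> h m' n)
     = (\<Sum>(m, n)\<in>layer N. h m n :: 'a::comm_ring_1)"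
  by (rule sum.reindex_bij_witness_not_neutral [symmetric, where
        S' = "{}" and T' = "layer (Suc (Suc N)) \<inter> {0} \<times> UNIV" and
        j = "\<lambda>(m, n). (Suc m, n)" and i = "\<lambda>(m, n). (m - 1, n)"])
     (auto simp: layer_def intro: finite_subset [OF _ finite_layer] split: nat.splits)

lemma sum_layer_pred_snd:
  "(\<Sum>(m, n)\<in>layer (Suc N). case n of 0 \<Rightarrow> 0 | Suc n' \<Rightarrow> h m n')
     = (\<Sum>(m, n)\<in>layer N. h m n :: 'a::comm_ring_1)"
  by (rule sum.reindex_bij_witness_not_neutral [symmetric, where
        S' = "{}" and T' = "layer (Suc N) \<inter> UNIV \<times> {0}" and
        j = "\<lambda>(m, n). (m, Suc n)" and i = "\<lambda>(m, n). (m, n - 1)"])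
     (auto simp: layer_def intro: finite_subset [OF _ finite_layer] split: nat.splits)

lemma layer_sum_0: "layer_sum q 0 = 1"
proof -
  have "layer 0 = {(0, 0)}" by (auto simp: layer_def)
  then show ?thesis by (simp add: layer_sum_def weight_0_0)
qed

lemma layer_sum_1: "layer_sum q (Suc 0) = q"
proof -
  have "layer (Suc 0) = {(0, Suc 0)}" by (auto simp: layer_def) arith
  then show ?thesis
    by (simp add: layer_sum_def weight_recurrence [of 0 "Suc 0" 0] weight_0_0)
qed

lemma layer_sum_recurrence:
  "layer_sum q (Suc (Suc N))
     = q ^ Suc (Suc N) * ((1 - q ^ Suc N) * layer_sum q N + layer_sum q (Suc N))"
proof -
  let ?A = "\<lambda>(m, n). case m of 0 \<Rightarrow> 0 | Suc m' \<Rightarrow> weight q m' n"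
  let ?B = "\<lambda>(m, n). case n of 0 \<Rightarrow> 0 | Suc n' \<Rightarrow> weight q m n'"
  have "layer_sum q (Suc (Suc N))
      = (\<Sum>p\<in>layer (Suc (Suc N)). q ^ Suc (Suc N) * ((1 - q ^ Suc N) * ?A p + ?B p))"
    unfolding layer_sum_def
  proof (intro sum.cong refl)
    fix p assume "p \<in> layer (Suc (Suc N))"
    then obtain m n where p: "p = (m, n)" and "2 * m + n = Suc (Suc N)"
      by (auto simp: layer_def)
    from weight_recurrence [OF this(2)]
    show "(case p of (m, n) \<Rightarrow> weight q m n) = q ^ Suc (Suc N) * ((1 - q ^ Suc N) * ?A p + ?B p)"
      by (simp only: p prod.case)
  qed
  also have "\<dots> = q ^ Suc (Suc N) * ((1 - q ^ Suc N) * sum ?A (layer (Suc (Suc N)))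
                                      + sum ?B (layer (Suc (Suc N))))"
    by (simp only: sum_distrib_left [symmetric] sum.distrib)
  also have "sum ?A (layer (Suc (Suc N))) = layer_sum q N"
    unfolding layer_sum_def by (rule sum_layer_pred_fst)
  also have "sum ?B (layer (Suc (Suc N))) = layer_sum q (Suc N)"
    unfolding layer_sum_def by (rule sum_layer_pred_snd)
  finally show ?thesis .
qed

lemma power_dvd_layer_sum: "q ^ N dvd layer_sum q N"
  unfolding layer_sum_def
  by (rule dvd_sum) (use power_dvd_weight [of q] in \<open>auto simp: layer_def\<close>)


section \<open>The functional equation modulo powers of q\<close>

text \<open>
  Multiplying by the denominator \<open>(x q;q)\<^sub>N\<close> turns the trinomial product into the numerator, by
  \<open>(1 + z + z\<^sup>2) (1 - z) = 1 - z\<^sup>3\<close>, so that the quotient can be compared with the series without inverting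
  anything at a finite stage.
\<close>

lemma qpoch_cube:
  fixes q x :: "'a::comm_ring_1"
  shows "(\<Prod>j=1..N. 1 + x * q ^ j + (x * q ^ j)\<^sup>2) * qpoch (x * q) q N
           = qpoch (x ^ 3 * q ^ 3) (q ^ 3) N"
proof -
  have "(1 + x * q ^ j + (x * q ^ j)\<^sup>2) * (1 - x * q * q ^ (j - 1))
          = 1 - x ^ 3 * q ^ 3 * (q ^ 3) ^ (j - 1)" if "1 \<le> j" for j
  proof -
    have q: "q * q ^ (j - 1) = q ^ j" "q ^ 3 * (q ^ 3) ^ (j - 1) = (q ^ j) ^ 3"
      using that by (cases j; simp add: power_mult_distrib flip: power_mult; simp add: mult.commute)+
    have cube: "(1 + z + z\<^sup>2) * (1 - z) = 1 - z ^ 3" for z :: 'a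
      by (simp add: algebra_simps power2_eq_square power3_eq_cube)
    have "x * q * q ^ (j - 1) = x * q ^ j" "x ^ 3 * q ^ 3 * (q ^ 3) ^ (j - 1) = (x * q ^ j) ^ 3"
      by (simp_all only: q mult.assoc power_mult_distrib)
    then show ?thesis
      using cube [of "x * q ^ j"] by (simp only:)
  qed
  then show ?thesis
    unfolding qpoch_def prod.distrib [symmetric] by (intro prod.cong) auto
qed

text \<open>
  The variables \<open>q\<close> and \<open>x\<close> are elements of an arbitrary commutative ring, and \<open>f\<close> is any sequence with the
  recurrence that the functional equation \<open>F(x) = (1 + x q + x\<^sup>2 q\<^sup>2) F(x q)\<close> imposes on the coefficients
  of \<open>F\<close>. Divisibility of \<open>f n\<close> by \<open>q ^ n\<close> is what makes truncating the series harmless modulo powers of \<open>q\<close>.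
\<close>

locale trinomial_coefficients =
  fixes q x :: "'a::comm_ring_1" and f :: "nat \<Rightarrow> 'a"
  assumes f_0: "f 0 = 1"
    and f_1: "(1 - q) * f (Suc 0) = q"
    and f_rec: "\<And>n. (1 - q ^ Suc (Suc n)) * f (Suc (Suc n))
                       = q ^ Suc (Suc n) * (f (Suc n) + f n)"
    and f_dvd: "\<And>n. q ^ n dvd f n"
begin

definition partial_sum :: "nat \<Rightarrow> nat \<Rightarrow> 'a" where
  "partial_sum i N = (\<Sum>n\<le>N. f n * (x * q ^ i) ^ n)"

text \<open>
  With \<open>y = x q\<^sup>i\<^sup>+\<^sup>1\<close>, the partial sums satisfy the functional equation up to the terms that multiplication
  by \<open>1 + y + y\<^sup>2\<close> pushes beyond the truncation point.
\<close>

lemma partial_sum_shift_exact: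
  fixes i :: nat
  defines "y \<equiv> x * q ^ Suc i"
  shows "partial_sum i (Suc N)
           = (1 + y + y\<^sup>2) * partial_sum (Suc i) (Suc N)
               - ((y + y\<^sup>2) * (f (Suc N) * y ^ Suc N) + y\<^sup>2 * (f N * y ^ N))"
proof (induction N)
  case 0
  have "f (Suc 0) = q + q * f (Suc 0)"
    using f_1 by (simp add: algebra_simps)
  then have "f (Suc 0) * (x * q ^ i) = (q + q * f (Suc 0)) * (x * q ^ i)"
    by simp
  also have "\<dots> = y + f (Suc 0) * y"
    by (simp add: y_def algebra_simps)
  finally have "f (Suc 0) * (x * q ^ i) = y + f (Suc 0) * y" .
  then have "partial_sum i (Suc 0) = 1 + y + f (Suc 0) * y"
    by (simp add: partial_sum_def f_0 add.assoc)
  moreover have "partial_sum (Suc i) (Suc 0) = 1 + f (Suc 0) * y"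
    by (simp add: partial_sum_def f_0 y_def)
  ultimately show ?case
    by (simp add: f_0 algebra_simps power2_eq_square)
next
  case (Suc N)
  let ?n = "Suc (Suc N)"
  have y_power: "y ^ ?n = q ^ ?n * (x * q ^ i) ^ ?n"
    by (simp only: y_def power_Suc [of q i] mult.left_commute [of x q] power_mult_distrib)
  have "f ?n * (x * q ^ i) ^ ?n = ((1 - q ^ ?n) * f ?n) * (x * q ^ i) ^ ?n + f ?n * y ^ ?n"
  proof -
    have "f ?n * z = ((1 - c) * f ?n) * z + f ?n * (c * z)" for c z
      by (simp add: algebra_simps)
    then show ?thesis
      by (simp only: y_power)
  qed
  also have "((1 - q ^ ?n) * f ?n) * (x * q ^ i) ^ ?n = (f (Suc N) + f N) * y ^ ?n"
    unfolding f_rec y_power by (simp only: mult_ac)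
  finally have new: "f ?n * (x * q ^ i) ^ ?n = (f (Suc N) + f N) * y ^ ?n + f ?n * y ^ ?n" .
  have "partial_sum i ?n = partial_sum i (Suc N) + ((f (Suc N) + f N) * y ^ ?n + f ?n * y ^ ?n)"
    by (simp only: partial_sum_def sum.atMost_Suc [of _ "Suc N"] new)
  moreover have "partial_sum (Suc i) ?n = partial_sum (Suc i) (Suc N) + f ?n * y ^ ?n"
    by (simp only: partial_sum_def sum.atMost_Suc [of _ "Suc N"] y_def)
  ultimately show ?case
    unfolding Suc by (simp add: algebra_simps power2_eq_square)
qed

lemma partial_sum_shift:
  "q ^ N dvd partial_sum i (Suc N)
               - (1 + x * q ^ Suc i + (x * q ^ Suc i)\<^sup>2) * partial_sum (Suc i) (Suc N)"
proof -
  have "q ^ N dvd f (Suc N)"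
    using f_dvd [of "Suc N"] by (rule dvd_trans [OF le_imp_power_dvd, rotated]) simp
  then show ?thesis
    using f_dvd [of N] by (simp add: partial_sum_shift_exact [of i N] dvd_add)
qed

text \<open>
  Only the constant term of \<open>F(x q\<^sup>i)\<close> survives modulo \<open>q\<^sup>i\<close>.
\<close>

lemma partial_sum_cong_1: "q ^ i dvd partial_sum i N - 1"
proof -
  have "partial_sum i N = 1 + (\<Sum>n\<in>{1..N}. f n * (x * q ^ i) ^ n)"
    unfolding partial_sum_def by (simp add: f_0 atMost_atLeast0 sum.atLeast_Suc_atMost)
  moreover have "q ^ i dvd (\<Sum>n\<in>{1..N}. f n * (x * q ^ i) ^ n)"
  proof (rule dvd_sum)
    fix n assume "n \<in> {1..N}"
    then have "n = Suc (n - 1)" by simp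
    then have "(x * q ^ i) ^ n = (x * q ^ i) * (x * q ^ i) ^ (n - 1)"
      by (metis power_Suc)
    then show "q ^ i dvd f n * (x * q ^ i) ^ n"
      by simp
  qed
  ultimately show ?thesis by simp
qed

lemma partial_sum_cong_product:
  "q ^ N dvd partial_sum 0 (Suc N) - (\<Prod>j=1..N. 1 + x * q ^ j + (x * q ^ j)\<^sup>2)"
proof -
  let ?P = "\<lambda>M. \<Prod>j=1..M. 1 + x * q ^ j + (x * q ^ j)\<^sup>2"
  have "q ^ N dvd partial_sum 0 (Suc N) - ?P M * partial_sum M (Suc N)" for M
  proof (induction M)
    case (Suc M)
    let ?c = "1 + x * q ^ Suc M + (x * q ^ Suc M)\<^sup>2"
    have "q ^ N dvd ?P M * (partial_sum M (Suc N) - ?c * partial_sum (Suc M) (Suc N))"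
      by (intro dvd_mult partial_sum_shift)
    from dvd_add [OF Suc.IH this] show ?case
      by (simp add: algebra_simps)
  qed simp
  moreover have "q ^ N dvd ?P N * (partial_sum N (Suc N) - 1)"
    by (intro dvd_mult partial_sum_cong_1)
  ultimately have "q ^ N dvd (partial_sum 0 (Suc N) - ?P N * partial_sum N (Suc N))
                      + ?P N * (partial_sum N (Suc N) - 1)"
    by (rule dvd_add)
  then show ?thesis
    by (simp add: algebra_simps)
qed

end


section \<open>Passage to the limit in power series\<close>

text \<open>
  The coefficient ring \<open>\<rat>[[x]]\<close> is not a field, so inversion and division of series in \<open>q\<close> behave well only for
  suitable constant terms. All denominators here have constant term \<open>1\<close>.
\<close>

lemma rat_fps_fps_inverse:
  fixes h :: "rat fps fps"
  assumes "fps_nth h 0 = 1"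
  shows "h * inverse h = 1"
  using fps_right_inverse [of h "inverse (fps_nth h 0)"] assms
  by (simp add: fps_inverse_def [of h])

lemma rat_fps_fps_divide:
  fixes h :: "rat fps fps"
  assumes "fps_nth h 0 = 1"
  shows "g / h = g * inverse h"
  using assms by (simp add: fps_divide_unit)

lemma fps_X_power_dvd_imp_nth_eq:
  fixes g h :: "'a::comm_ring_1 fps"
  assumes "fps_X ^ n dvd g - h" and "k < n"
  shows "fps_nth g k = fps_nth h k"
proof -
  obtain d where "g - h = fps_X ^ n * d"
    using assms(1) by blast
  then have "fps_nth (g - h) k = 0"
    using assms(2) by (simp add: fps_X_power_mult_nth)
  then show ?thesis by simp
qed

lemma fps_X_power_dvd_iff_nth:
  fixes g :: "'a::comm_ring_1 fps"
  shows "fps_X ^ n dvd g \<longleftrightarrow> (\<forall>k<n. fps_nth g k = 0)"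
proof
  assume "\<forall>k<n. fps_nth g k = 0"
  then have "g = fps_X ^ n * fps_shift n g"
    by (intro fps_ext) (simp add: fps_X_power_mult_nth)
  then show "fps_X ^ n dvd g" by (metis dvd_triv_left)
qed (auto simp: fps_X_power_mult_nth elim!: dvdE)

lemma tendsto_fps_imp_eventually_dvd:
  fixes L :: "'a::comm_ring_1 fps"
  assumes "(g \<longlongrightarrow> L) F"
  shows "eventually (\<lambda>N. fps_X ^ n dvd g N - L) F"
proof -
  have "eventually (\<lambda>N. \<forall>k\<in>{..<n}. fps_nth (g N) k = fps_nth L k) F"
    using assms by (intro eventually_ball_finite) (auto simp: tendsto_fps_iff)
  then show ?thesis
    by eventually_elim (simp add: fps_X_power_dvd_iff_nth)
qed

lemma qpoch_nth_0:
  assumes "fps_nth a 0 = 0"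
  shows "fps_nth (qpoch a q n) 0 = 1"
  unfolding qpoch_def using assms by (induction n) simp_all

lemma qpoch_inf_nth_0:
  fixes a q :: "'a::comm_ring_1 fps"
  assumes "fps_nth a 0 = 0" "fps_nth q 0 = 0"
  shows "fps_nth (qpoch_inf a q) 0 = 1"
proof -
  have "eventually (\<lambda>n. fps_nth (qpoch a q n) 0 = fps_nth (qpoch_inf a q) 0) sequentially"
    using qpoch_tendsto_qpoch_inf [OF assms(2)] unfolding tendsto_fps_iff by blast
  then show ?thesis
    using assms(1) by (simp add: qpoch_nth_0)
qed

text \<open>
  The coefficient of \<open>x\<^sup>N\<close> in the double series, a power series in \<open>q\<close> alone; that it satisfies the recurrence of
  the locale is the point where the polynomials \<open>b(m,n)\<close> meet the product.
\<close>

definition series_coeff :: "nat \<Rightarrow> rat fps fps" where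
  "series_coeff N = layer_sum var_q N * inverse (qpoch var_q var_q N)"

lemma qpoch_q_Suc: "qpoch q q (Suc n) = (1 - q ^ Suc n) * qpoch q q n"
  by (simp add: qpoch_def mult.commute)

lemma inverse_qpoch_Suc:
  "(1 - var_q ^ Suc n) * inverse (qpoch var_q var_q (Suc n)) = inverse (qpoch var_q var_q n)"
proof -
  let ?Q = "qpoch var_q var_q"
  have inv: "?Q k * inverse (?Q k) = 1" for k
    by (intro rat_fps_fps_inverse qpoch_nth_0) simp
  have "inverse (?Q n) = inverse (?Q n) * (?Q (Suc n) * inverse (?Q (Suc n)))"
    by (simp add: inv)
  also have "\<dots> = (?Q n * inverse (?Q n)) * ((1 - var_q ^ Suc n) * inverse (?Q (Suc n)))"
    by (simp only: qpoch_q_Suc mult_ac)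
  finally show ?thesis by (simp add: inv)
qed

interpretation trinomial_coefficients var_q var_x series_coeff
proof
  let ?v = "\<lambda>n. inverse (qpoch var_q var_q n)"
  have v_0: "?v 0 = 1"
    using rat_fps_fps_inverse [of "qpoch var_q var_q 0"] by (simp add: qpoch_def)
  show "series_coeff 0 = 1"
    by (simp add: series_coeff_def layer_sum_0 v_0)
  show "(1 - var_q) * series_coeff (Suc 0) = var_q"
    using inverse_qpoch_Suc [of 0] by (simp add: series_coeff_def layer_sum_1 v_0 mult_ac)
  show "var_q ^ n dvd series_coeff n" for n
    unfolding series_coeff_def by (intro dvd_mult2 power_dvd_layer_sum)
  fix n
  have "(1 - var_q ^ Suc (Suc n)) * series_coeff (Suc (Suc n))
      = layer_sum var_q (Suc (Suc n)) * ?v (Suc n)"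
    unfolding series_coeff_def inverse_qpoch_Suc [of "Suc n", symmetric] by (simp only: mult_ac)
  also have "\<dots> = var_q ^ Suc (Suc n) *
      (layer_sum var_q n * ((1 - var_q ^ Suc n) * ?v (Suc n)) + layer_sum var_q (Suc n) * ?v (Suc n))"
    unfolding layer_sum_recurrence by (simp only: algebra_simps)
  also have "\<dots> = var_q ^ Suc (Suc n) * (series_coeff (Suc n) + series_coeff n)"
    unfolding inverse_qpoch_Suc series_coeff_def by (simp only: add.commute)
  finally show "(1 - var_q ^ Suc (Suc n)) * series_coeff (Suc (Suc n))
      = var_q ^ Suc (Suc n) * (series_coeff (Suc n) + series_coeff n)" .
qed

lemma partial_sum_tendsto:
  "partial_sum 0 \<longlonglongrightarrow> qpoch_inf (var_x ^ 3 * var_q ^ 3) (var_q ^ 3) / qpoch_inf (var_x * var_q) var_q"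
proof (rule tendsto_fpsI)
  fix k
  let ?A = "qpoch (var_x ^ 3 * var_q ^ 3) (var_q ^ 3)"
  let ?B = "qpoch (var_x * var_q) var_q"
  let ?A' = "qpoch_inf (var_x ^ 3 * var_q ^ 3) (var_q ^ 3)"
  let ?B' = "qpoch_inf (var_x * var_q) var_q"
  let ?K = "Suc k"
  have B'_0: "fps_nth ?B' 0 = 1"
    by (rule qpoch_inf_nth_0) simp_all
  have "eventually (\<lambda>N. var_q ^ ?K dvd ?A N - ?A') sequentially"
    by (intro tendsto_fps_imp_eventually_dvd qpoch_tendsto_qpoch_inf) simp
  moreover have "eventually (\<lambda>N. var_q ^ ?K dvd ?B N - ?B') sequentially"
    by (intro tendsto_fps_imp_eventually_dvd qpoch_tendsto_qpoch_inf) simp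
  ultimately have "eventually (\<lambda>N. fps_nth (partial_sum 0 (Suc N)) k = fps_nth (?A' / ?B') k) sequentially"
    using eventually_ge_at_top [of ?K]
  proof eventually_elim
    case (elim N)
    let ?S = "partial_sum 0 (Suc N)"
    let ?P = "\<Prod>j=1..N. 1 + var_x * var_q ^ j + (var_x * var_q ^ j)\<^sup>2"
    have "var_q ^ ?K dvd ?S - ?P"
      using partial_sum_cong_product elim(3) by (rule dvd_trans [OF le_imp_power_dvd, rotated])
    then have "var_q ^ ?K dvd (?S - ?P) * ?B N"
      by (rule dvd_mult2)
    then have SB: "var_q ^ ?K dvd ?S * ?B N - ?A N"
      by (simp only: left_diff_distrib qpoch_cube)
    \<comment> \<open>Replace both finite products by their limits, then divide by the limit of the denominator.\<close>
    have "var_q ^ ?K dvd ((?S * ?B N - ?A N) - ?S * (?B N - ?B') + (?A N - ?A')) * inverse ?B'"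
      by (intro dvd_mult2 dvd_add dvd_diff SB dvd_mult elim)
    also have "((?S * ?B N - ?A N) - ?S * (?B N - ?B') + (?A N - ?A')) * inverse ?B'
        = ?S * (?B' * inverse ?B') - ?A' * inverse ?B'"
      by (simp add: algebra_simps)
    also have "\<dots> = ?S - ?A' / ?B'"
      by (simp add: rat_fps_fps_inverse rat_fps_fps_divide B'_0)
    finally show ?case
      by (rule fps_X_power_dvd_imp_nth_eq) simp
  qed
  then show "eventually (\<lambda>N. fps_nth (partial_sum 0 N) k = fps_nth (?A' / ?B') k) sequentially"
    by (rule eventually_sequentially_Suc [THEN iffD1])
qed

text \<open>
  A double series indexed by \<open>(m,n)\<close> may be summed layer by layer, since modulo any power of \<open>q\<close> only finitely
  many layers contribute.
\<close>

lemma has_sum_by_layers: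
  fixes t :: "nat \<times> nat \<Rightarrow> 'a::comm_ring_1 fps"
  assumes dvd: "\<And>m n. fps_X ^ (2 * m + n) dvd t (m, n)"
    and lim: "(\<lambda>N. \<Sum>n\<le>N. sum t (layer n)) \<longlonglongrightarrow> L"
  shows "(t has_sum L) UNIV"
proof (rule has_sum_fpsI)
  fix k
  let ?U = "\<lambda>N. \<Union>n\<le>N. layer n"
  let ?supp = "{p \<in> UNIV. fps_nth (t p) k \<noteq> 0}"
  have supp: "?supp \<subseteq> ?U k"
  proof
    fix p assume p: "p \<in> ?supp"
    obtain m n where mn: "p = (m, n)" by fastforce
    have "2 * m + n \<le> k"
    proof (rule ccontr)
      assume "\<not> 2 * m + n \<le> k"
      with dvd [of m n] have "fps_nth (t p) k = 0"
        by (simp add: fps_X_power_dvd_iff_nth mn)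
      with p show False by simp
    qed
    then show "p \<in> ?U k" by (simp add: layer_def mn)
  qed
  show "finite ?supp"
    by (rule finite_subset [OF supp]) simp
  have "eventually (\<lambda>N. fps_nth (\<Sum>n\<le>N. sum t (layer n)) k = fps_nth L k) sequentially"
    using lim unfolding tendsto_fps_iff by blast
  then have "eventually (\<lambda>N. fps_nth L k = (\<Sum>p\<in>?supp. fps_nth (t p) k)) sequentially"
    using eventually_ge_at_top [of k]
  proof eventually_elim
    case (elim N)
    have "layer i \<inter> layer j = {}" if "i \<noteq> j" for i j
      using that by (auto simp: layer_def)
    then have "(\<Sum>n\<le>N. sum t (layer n)) = sum t (?U N)"
      by (simp add: sum.UNION_disjoint)
    then have "fps_nth L k = (\<Sum>p\<in>?U N. fps_nth (t p) k)"
      using elim(1) by (simp add: fps_sum_nth)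
    also have "\<dots> = (\<Sum>p\<in>?supp. fps_nth (t p) k)"
    proof (rule sum.mono_neutral_right)
      show "?supp \<subseteq> ?U N"
        using supp elim(2) by force
    qed auto
    finally show ?case .
  qed
  then show "fps_nth L k = (\<Sum>p\<in>?supp. fps_nth (t p) k)"
    by simp
qed

theorem theorem1:
  shows "((\<lambda>(m::nat, n::nat).
            var_q ^ (((m + n + 1) choose 2) + ((m + 1) choose 2)) * (1 - var_q) ^ m * var_x ^ (2 * m + n)
              / qpoch var_q var_q (2 * m + n)
            * poly (map_poly of_int (bpoly (int m) (int n))) var_q)
          has_sum (qpoch_inf (var_x ^ 3 * var_q ^ 3) (var_q ^ 3) / qpoch_inf (var_x * var_q) var_q)) UNIV"
    (is "(?t has_sum ?L) UNIV")
proof (rule has_sum_by_layers)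
  have t: "?t (m, n) = weight var_q m n * (inverse (qpoch var_q var_q (2 * m + n)) * var_x ^ (2 * m + n))"
    for m n
    by (simp add: weight_def int_poly_eval_def rat_fps_fps_divide qpoch_nth_0 mult_ac)
  show "var_q ^ (2 * m + n) dvd ?t (m, n)" for m n
    unfolding t by (intro dvd_mult2 power_dvd_weight)
  have "sum ?t (layer N) = series_coeff N * (var_x * var_q ^ 0) ^ N" for N
  proof -
    have "sum ?t (layer N)
        = (\<Sum>(m, n)\<in>layer N. weight var_q m n * (inverse (qpoch var_q var_q N) * var_x ^ N))"
    proof (intro sum.cong refl)
      fix p assume "p \<in> layer N"
      then obtain m n where "p = (m, n)" and "2 * m + n = N"
        by (auto simp: layer_def)
      then show "?t p = (case p of (m, n) \<Rightarrow>
          weight var_q m n * (inverse (qpoch var_q var_q N) * var_x ^ N))"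
        using t [of m n] by (simp only: prod.case)
    qed
    then show ?thesis
      by (simp add: series_coeff_def layer_sum_def sum_distrib_right case_prod_beta mult.assoc)
  qed
  then have "(\<lambda>N. \<Sum>n\<le>N. sum ?t (layer n)) = partial_sum 0"
    by (simp add: partial_sum_def fun_eq_iff)
  then show "(\<lambda>N. \<Sum>n\<le>N. sum ?t (layer n)) \<longlonglongrightarrow> ?L"
    using partial_sum_tendsto by simp
qed

end
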